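(* Let $L>0$ and let $N^+,N,\overline N,N^-$ be real numbers with $N^+N^--\overline N N=L^2$. Let $(a_j,\bar a_j)\in\mathbb{R}^2$, $j=1,2,3,4$, satisfy $$N^-\bar a_ja_j-N\bar a_jL-\overline N a_jL+N^+L^2=0,\qquad a_1<a_3<a_4<a_2,\qquad \bar a_1<\bar a_3<\bar a_4<\bar a_2 .$$ Put $r_{jk}=\frac12\sqrt{(a_j-a_k)(\bar a_j-\bar a_k)}$ and $\Lambda_{ij,k}=\frac{r_{ij}}{r_{ik}r_{jk}}$. Let $Z_j\in\mathbb{R}^{2,2}$ be the null vector with $$\begin{pmatrix}Z_j^+&Z_j^0+Z_j^2\\ Z_j^0-Z_j^2&Z_j^-\end{pmatrix}=\begin{pmatrix}a_j\bar a_j&La_j\\ L\bar a_j&L^2\end{pmatrix}$$ and define $$p_1=-\Lambda_{24,1}Z_1,\quad p_2=\Lambda_{13,2}Z_2,\quad p_3=-\Lambda_{24,3}Z_3,\quad p_4=\Lambda_{13,4}Z_4 .$$ Then momentum conservation holds: $p_1+p_2=p_3+p_4$. Moreover, the vectors $$V_1=L^2\Big(\tfrac{p_3+p_4}{p_3\cdot p_4}-\tfrac{p_1+p_4}{p_1\cdot p_4}\Big),\quad V_2=L^2\Big(\tfrac{p_2-p_1}{p_1\cdot p_2}-\tfrac{p_2-p_3}{p_2\cdot p_3}\Big),$$ $$V_3=L^2\Big(\tfrac{p_2+p_3}{p_2\cdot p_3}-\tfrac{p_1+p_2}{p_1\cdot p_2}\Big),\quad V_4=L^2\Big(\tfrac{p_3-p_4}{p_3\cdot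 p_4}-\tfrac{p_1-p_4}{p_1\cdot p_4}\Big)$$ are the four vertices of the world sheet of a string segment in $AdS_3$ with edge vectors $p_j$: one has $V_i\cdot V_i=-L^2$ for all $i$, $p_1=V_2-V_1$, $p_2=V_3-V_2$, $p_3=V_3-V_4$, $p_4=V_4-V_1$, $V_i\cdot V_j=-L^2$ for $(ij)=(12),(23),(34),(14)$, and the vertices satisfy the interpolation ansatz $$V_3=\frac{L^2+\frac12p_1\cdot p_4}{L^2-\frac12p_1\cdot p_4}V_1+\frac{L^2}{L^2-\frac12p_1\cdot p_4}(p_1+p_4)$$ and the scattering equation $V_3=-V_1-4L^2\frac{V_2+V_4}{(V_2+V_4)\cdot(V_2+V_4)}$.
   Context: $\mathbb{R}^{2,2}$ has coordinates $X^{-1},X^0,X^1,X^2$ and bilinear form $X\cdot Y=-X^{-1}Y^{-1}-X^0Y^0+X^1Y^1+X^2Y^2$; $X^\pm=X^1\pm X^{-1}$. $AdS_3=\{X\in\mathbb{R}^{2,2}: X\cdot X=-L^2\}$. *)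

theory Defs
  imports "HOL-Analysis.Analysis"
begin

text \<open>
  The index type \<open>4\<close> is the integers modulo 4, with the four distinct elements
  \<open>-1, 0, 1, 2\<close>, so the coordinates can keep their labels: \<open>X $ (-1)\<close>, \<open>X $ 0\<close>, \<open>X $ 1\<close>, \<open>X $ 2\<close>.
\<close>

type_synonym R22 = "real ^ 4"

definition form22 :: "R22 \<Rightarrow> R22 \<Rightarrow> real" (infixl "\<odot>" 70) where
  "X \<odot> Y = - (X $ (-1)) * (Y $ (-1)) - (X $ 0) * (Y $ 0) + (X $ 1) * (Y $ 1) + (X $ 2) * (Y $ 2)"

definition AdS3 :: "real \<Rightarrow> R22 set" where
  "AdS3 L = {X. X \<odot> X = - (L ^ 2)}"

definition cplus :: "R22 \<Rightarrow> real" where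
  "cplus X = X $ 1 + X $ (-1)"

definition cminus :: "R22 \<Rightarrow> real" where
  "cminus X = X $ 1 - X $ (-1)"

definition matrix22 :: "R22 \<Rightarrow> real ^ 2 ^ 2" where
  "matrix22 X = vector [vector [cplus X, X $ 0 + X $ 2],
                        vector [X $ 0 - X $ 2, cminus X]]"

lemma form22_eq_det_matrix22: "X \<odot> X = det (matrix22 X)"
  unfolding det_2 form22_def matrix22_def cplus_def cminus_def vector_2
  by (simp add: algebra_simps)

lemma ex1_matrix22: "\<exists>!X. matrix22 X = vector [vector [p, q], vector [r, s]]"
proof -
  have d: "(0::4) \<noteq> -1" "(1::4) \<noteq> -1" "(2::4) \<noteq> -1" "(1::4) \<noteq> 0" "(2::4) \<noteq> 0" "(2::4) \<noteq> 1"
    by simp_all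
  have c: "(4::4) = 0" "(3::4) = -1"
    by simp_all
  have m: "matrix22 X = vector [vector [p, q], vector [r, s]] \<longleftrightarrow>
      X $ 1 + X $ (-1) = p \<and> X $ 0 + X $ 2 = q \<and> X $ 0 - X $ 2 = r \<and> X $ 1 - X $ (-1) = s" for X
    unfolding matrix22_def cplus_def cminus_def vec_eq_iff forall_2 vector_2 by auto
  let ?X = "(\<chi> i. if i = -1 then (p - s) / 2 else if i = 0 then (q + r) / 2
                 else if i = 1 then (p + s) / 2 else (q - r) / 2) :: R22"
  show ?thesis
  proof (rule ex1I[of _ ?X])
    show "matrix22 ?X = vector [vector [p, q], vector [r, s]]"
      unfolding m using d by (simp add: field_simps)
  next
    fix X
    assume "matrix22 X = vector [vector [p, q], vector [r, s]]"
    then have e: "X $ 1 + X $ (-1) = p" "X $ 0 + X $ 2 = q" "X $ 0 - X $ 2 = r" "X $ 1 - X $ (-1) = s"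
      unfolding m by auto
    show "X = ?X"
      unfolding vec_eq_iff forall_4 c using d e by auto
  qed
qed

text \<open>The sequences \<open>a\<close> and \<open>b\<close> hold the first and second components of the pairs.\<close>

definition rdist :: "(nat \<Rightarrow> real) \<Rightarrow> (nat \<Rightarrow> real) \<Rightarrow> nat \<Rightarrow> nat \<Rightarrow> real" where
  "rdist a b j k = 1 / 2 * sqrt ((a j - a k) * (b j - b k))"

definition Lam :: "(nat \<Rightarrow> real) \<Rightarrow> (nat \<Rightarrow> real) \<Rightarrow> nat \<Rightarrow> nat \<Rightarrow> nat \<Rightarrow> real" where
  "Lam a b i j k = rdist a b i j / (rdist a b i k * rdist a b j k)"

end

theory Submission
  imports Defs
begin

text \<open>
  The equation relating \<open>a\<^sub>j\<close> and \<open>b\<^sub>j\<close> makes \<open>b\<^sub>j\<close> a Moebius function of \<open>a\<^sub>j\<close>, so that with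
  \<open>q\<^sub>j = \<bar>Nm a\<^sub>j - N L\<bar> / L\<^sup>2\<close> one has \<open>(b\<^sub>j - b\<^sub>k) q\<^sub>j q\<^sub>k = a\<^sub>j - a\<^sub>k\<close>. Hence all square roots drop out of
  \<open>\<Lambda>\<close>, and \<open>q\<^sub>j Z\<^sub>j\<close> is a quadratic polynomial in \<open>a\<^sub>j\<close>. Momentum conservation then says that the third
  divided difference of a quadratic polynomial vanishes, and Ptolemy's relation
  \<open>r\<^sub>1\<^sub>4 r\<^sub>2\<^sub>3 - r\<^sub>1\<^sub>2 r\<^sub>3\<^sub>4 = r\<^sub>1\<^sub>3 r\<^sub>2\<^sub>4\<close> becomes \<open>u v = 2 L\<^sup>2 (u - v)\<close> for \<open>u = p\<^sub>1 \<cdot> p\<^sub>2\<close> and \<open>v = p\<^sub>1 \<cdot> p\<^sub>4\<close>.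
  Everything else follows from this relation by bilinear algebra.
\<close>

section \<open>World sheet geometry from four null momenta\<close>

lemma form22_commute: "X \<odot> Y = Y \<odot> X"
  by (simp add: form22_def algebra_simps)

lemma form22_bilinear:
  "(X + Y) \<odot> W = X \<odot> W + Y \<odot> W" "(X - Y) \<odot> W = X \<odot> W - Y \<odot> W"
  "W \<odot> (X + Y) = W \<odot> X + W \<odot> Y" "W \<odot> (X - Y) = W \<odot> X - W \<odot> Y"
  "(c *\<^sub>R X) \<odot> W = c * (X \<odot> W)" "W \<odot> (c *\<^sub>R X) = c * (W \<odot> X)"
  by (simp_all add: form22_def algebra_simps)

text \<open>This isolates the part that sees only null, conserved momenta with two linked
  invariants; the points \<open>a j\<close>, \<open>b j\<close> and the square roots no longer
  occur.\<close>

lemma scattering_world_sheet: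
  fixes P1 P2 P3 P4 V1 V2 V3 V4 :: R22
  assumes "L > 0"
    and null: "P1 \<odot> P1 = 0" "P2 \<odot> P2 = 0" "P3 \<odot> P3 = 0" "P4 \<odot> P4 = 0"
    and cons: "P1 + P2 = P3 + P4"
    and u0: "P1 \<odot> P2 \<noteq> 0" and v0: "P1 \<odot> P4 < 0"
    and uv: "(P1 \<odot> P2) * (P1 \<odot> P4) = 2 * L ^ 2 * (P1 \<odot> P2 - P1 \<odot> P4)"
    and V1: "V1 = L ^ 2 *\<^sub>R ((P3 + P4) /\<^sub>R (P3 \<odot> P4) - (P1 + P4) /\<^sub>R (P1 \<odot> P4))"
    and V2: "V2 = L ^ 2 *\<^sub>R ((P2 - P1) /\<^sub>R (P1 \<odot> P2) - (P2 - P3) /\<^sub>R (P2 \<odot> P3))"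
    and V3: "V3 = L ^ 2 *\<^sub>R ((P2 + P3) /\<^sub>R (P2 \<odot> P3) - (P1 + P2) /\<^sub>R (P1 \<odot> P2))"
    and V4: "V4 = L ^ 2 *\<^sub>R ((P3 - P4) /\<^sub>R (P3 \<odot> P4) - (P1 - P4) /\<^sub>R (P1 \<odot> P4))"
  shows "P1 \<odot> P2 \<noteq> 0 \<and> P2 \<odot> P3 \<noteq> 0 \<and> P3 \<odot> P4 \<noteq> 0 \<and> P1 \<odot> P4 \<noteq> 0"
    and "V1 \<in> AdS3 L \<and> V2 \<in> AdS3 L \<and> V3 \<in> AdS3 L \<and> V4 \<in> AdS3 L"
    and "P1 = V2 - V1 \<and> P2 = V3 - V2 \<and> P3 = V3 - V4 \<and> P4 = V4 - V1"
    and "V1 \<odot> V2 = - (L ^ 2) \<and> V2 \<odot> V3 = - (L ^ 2) \<and> V3 \<odot> V4 = - (L ^ 2) \<and> V1 \<odot> V4 = - (L ^ 2)"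
    and "L ^ 2 - 1 / 2 * (P1 \<odot> P4) \<noteq> 0"
    and "V3 = ((L ^ 2 + 1 / 2 * (P1 \<odot> P4)) / (L ^ 2 - 1 / 2 * (P1 \<odot> P4))) *\<^sub>R V1
            + (L ^ 2 / (L ^ 2 - 1 / 2 * (P1 \<odot> P4))) *\<^sub>R (P1 + P4)"
    and "(V2 + V4) \<odot> (V2 + V4) \<noteq> 0"
    and "V3 = - V1 - (4 * L ^ 2) *\<^sub>R ((V2 + V4) /\<^sub>R ((V2 + V4) \<odot> (V2 + V4)))"
proof -
  define u v where "u = P1 \<odot> P2" and "v = P1 \<odot> P4"
  have P3: "P3 = P1 + P2 - P4"
    using cons by simp
  have sym: "P2 \<odot> P1 = u" "P4 \<odot> P1 = v" "P4 \<odot> P2 = P2 \<odot> P4"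
    unfolding u_def v_def by (simp_all add: form22_commute)
  \<comment> \<open>The massless Mandelstam relation: expanding \<open>P3 \<odot> P3 = 0\<close>
    gives 0 = 2 (u - v - P2.P4).\<close>
  have P24: "P2 \<odot> P4 = u - v"
    using \<open>P3 \<odot> P3 = 0\<close> null sym unfolding P3 form22_bilinear
    by (simp flip: u_def v_def)
  have forms: "P1 \<odot> P2 = u" "P1 \<odot> P4 = v" "P3 \<odot> P4 = u" "P2 \<odot> P3 = v"
    using null sym P24 unfolding P3 form22_bilinear by (simp_all flip: u_def v_def)
  have un: "u \<noteq> 0" and vn: "v < 0" and uvrel: "u * v = 2 * L\<^sup>2 * (u - v)"
    using u0 v0 uv unfolding u_def v_def by auto
  \<comment> \<open>These are the coefficients of the momenta in the vertices. Hypothesis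
    \<open>uv\<close>, divided by 2 u v, says exactly y - x = 1/2.\<close>
  define x y where "x = L\<^sup>2 / u" and "y = L\<^sup>2 / v"
  have xu: "x * u = L\<^sup>2" and yv: "y * v = L\<^sup>2"
    using un vn unfolding x_def y_def by auto
  have "y - x = 1 / 2"
    using un vn uvrel unfolding x_def y_def by (simp add: field_simps)
  then have y: "y = x + 1 / 2" by simp
  have V1': "V1 = x *\<^sub>R (P1 + P2) - y *\<^sub>R (P1 + P4)"
    unfolding V1 forms unfolding P3 x_def y_def by (simp add: algebra_simps divide_inverse)
  have V2': "V2 = x *\<^sub>R (P2 - P1) - y *\<^sub>R (P4 - P1)"
    unfolding V2 forms unfolding P3 x_def y_def by (simp add: algebra_simps divide_inverse)
  have V3': "V3 = y *\<^sub>R (P2 + P3) - x *\<^sub>R (P1 + P2)"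
    unfolding V3 forms unfolding x_def y_def by (simp add: algebra_simps divide_inverse)
  have V4': "V4 = x *\<^sub>R (P3 - P4) - y *\<^sub>R (P1 - P4)"
    unfolding V4 forms unfolding x_def y_def by (simp add: algebra_simps divide_inverse)
  \<comment> \<open>Each difference of adjacent vertices is 2 (y - x) times its edge vector, and 2
    (y - x) = 1.\<close>
  have e1: "P1 = V2 - V1" and e2: "P2 = V3 - V2" and e3: "P3 = V3 - V4" and e4: "P4 = V4 - V1"
    unfolding V1' V2' V3' V4' y P3 vec_eq_iff by (simp_all add: algebra_simps)
  have V1P1: "V1 \<odot> P1 = 0" and V1P4: "V1 \<odot> P4 = 0"
    unfolding V1' form22_bilinear using xu yv null sym P24 forms by (simp_all add: algebra_simps)
  have V1P2: "V1 \<odot> P2 = - u"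
  proof -
    have "V1 \<odot> P2 = x * u - y * (2 * u - v)"
      unfolding V1' form22_bilinear by (simp only: null sym P24 forms) simp
    also have "\<dots> = x * u + y * v - 2 * y * u" by (simp add: algebra_simps)
    also have "\<dots> = - u" using xu yv unfolding y by (simp add: algebra_simps)
    finally show ?thesis .
  qed
  have V1V1: "V1 \<odot> V1 = - L\<^sup>2"
  proof -
    have "V1 \<odot> V1 = x * (V1 \<odot> P1 + V1 \<odot> P2) - y * (V1 \<odot> P1 + V1 \<odot> P4)"
      by (subst (2) V1') (simp only: form22_bilinear)
    then show ?thesis using V1P1 V1P2 V1P4 xu by simp
  qed
  \<comment> \<open>With every vertex written as \<open>V1\<close> plus edges, all remaining
    products reduce to the short table \<open>vals\<close>.\<close>
  have W2: "V2 = V1 + P1" and W3: "V3 = V1 + P1 + P2" and W4: "V4 = V1 + P4"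
    using e1 e2 e4 by (simp_all add: algebra_simps)
  note vals = V1P1 V1P2 V1P4 V1V1 forms(1,2) null sym P24
    form22_commute[of P1 V1] form22_commute[of P2 V1] form22_commute[of P4 V1]
  \<comment> \<open>\<open>D\<close> is the denominator of the ansatz; it also equals x v and -1/4
    times the square of V2 + V4, which links the ansatz to the scattering equation.\<close>
  define D where "D = L\<^sup>2 - v / 2"
  have D: "D > 0"
    using zero_less_power[OF \<open>L > 0\<close>, of 2] vn unfolding D_def by linarith
  have sq: "(V2 + V4) \<odot> (V2 + V4) = - 4 * D"
    unfolding W2 W4 form22_bilinear D_def using vals by simp
  have "x * v = D"
    using yv unfolding y D_def by (simp add: algebra_simps)
  \<comment> \<open>Multiplying \<open>V1'\<close> by v clears its coefficients to D and L^2; the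
    result is solved for P1 + P2 = V3 - V1.\<close>
  have "v *\<^sub>R V1 + L\<^sup>2 *\<^sub>R (P1 + P4) = (x * v) *\<^sub>R (P1 + P2) - (y * v) *\<^sub>R (P1 + P4) + L\<^sup>2 *\<^sub>R (P1 + P4)"
    unfolding V1' by (simp add: algebra_simps)
  also have "\<dots> = D *\<^sub>R (P1 + P2)"
    using \<open>x * v = D\<close> yv by simp
  finally have "D *\<^sub>R (P1 + P2) = v *\<^sub>R V1 + L\<^sup>2 *\<^sub>R (P1 + P4)" by simp
  then have "D *\<^sub>R V3 = (D + v) *\<^sub>R V1 + L\<^sup>2 *\<^sub>R (P1 + P4)"
    unfolding W3 by (simp add: algebra_simps)
  then have "(1 / D) *\<^sub>R (D *\<^sub>R V3) = (1 / D) *\<^sub>R ((D + v) *\<^sub>R V1 + L\<^sup>2 *\<^sub>R (P1 + P4))" by simp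
  then have interp: "V3 = ((D + v) / D) *\<^sub>R V1 + (L\<^sup>2 / D) *\<^sub>R (P1 + P4)"
    using D by (simp add: scaleR_add_right)
  show "P1 \<odot> P2 \<noteq> 0 \<and> P2 \<odot> P3 \<noteq> 0 \<and> P3 \<odot> P4 \<noteq> 0 \<and> P1 \<odot> P4 \<noteq> 0"
    using forms un vn by simp
  show "V1 \<in> AdS3 L \<and> V2 \<in> AdS3 L \<and> V3 \<in> AdS3 L \<and> V4 \<in> AdS3 L"
    unfolding AdS3_def W2 W3 W4 mem_Collect_eq form22_bilinear using vals by simp
  show "P1 = V2 - V1 \<and> P2 = V3 - V2 \<and> P3 = V3 - V4 \<and> P4 = V4 - V1"
    using e1 e2 e3 e4 by blast
  show "V1 \<odot> V2 = - (L ^ 2) \<and> V2 \<odot> V3 = - (L ^ 2) \<and> V3 \<odot> V4 = - (L ^ 2) \<and> V1 \<odot> V4 = - (L ^ 2)"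
    unfolding W2 W3 W4 form22_bilinear using vals by simp
  show "L ^ 2 - 1 / 2 * (P1 \<odot> P4) \<noteq> 0"
    using D unfolding D_def forms by simp
  have "L\<^sup>2 + 1 / 2 * (P1 \<odot> P4) = D + v" "L\<^sup>2 - 1 / 2 * (P1 \<odot> P4) = D"
    unfolding forms D_def by simp_all
  then show "V3 = ((L ^ 2 + 1 / 2 * (P1 \<odot> P4)) / (L ^ 2 - 1 / 2 * (P1 \<odot> P4))) *\<^sub>R V1
            + (L ^ 2 / (L ^ 2 - 1 / 2 * (P1 \<odot> P4))) *\<^sub>R (P1 + P4)"
    using interp by simp
  show "(V2 + V4) \<odot> (V2 + V4) \<noteq> 0"
    using sq D by simp
  \<comment> \<open>Since D + v = 2 L^2 - D, the ansatz regroups around 2 V1 + P1 + P4 = V2 +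
    V4.\<close>
  have coeff: "(D + v) / D = 2 * (L\<^sup>2 / D) - 1"
    using D unfolding D_def by (simp add: field_simps)
  have "(2 * k - 1) *\<^sub>R V1 + k *\<^sub>R (P1 + P4) = - V1 + k *\<^sub>R (V2 + V4)" for k
    unfolding W2 W4 vec_eq_iff by (simp add: algebra_simps)
  from trans[OF interp[unfolded coeff] this]
  have "V3 = - V1 + (L\<^sup>2 / D) *\<^sub>R (V2 + V4)" .
  also have "(L\<^sup>2 / D) *\<^sub>R (V2 + V4) = - ((4 * L\<^sup>2) *\<^sub>R ((V2 + V4) /\<^sub>R ((V2 + V4) \<odot> (V2 + V4))))"
  proof -
    have "L\<^sup>2 / D = - (4 * L\<^sup>2 * inverse (- 4 * D))"
      using D by (simp add: field_simps)
    then show ?thesis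
      unfolding sq by (simp only: scaleR_scaleR scaleR_minus_left)
  qed
  finally show "V3 = - V1 - (4 * L ^ 2) *\<^sub>R ((V2 + V4) /\<^sub>R ((V2 + V4) \<odot> (V2 + V4)))" by simp
qed

section \<open>Null vectors, rational form of Lambda, and Moebius identities\<close>

lemma null_vector_coords:
  assumes "matrix22 X = vector [vector [s * t, L * s], vector [L * t, L\<^sup>2]]"
  shows "X $ 1 = (s * t + L\<^sup>2) / 2" "X $ (-1) = (s * t - L\<^sup>2) / 2"
    "X $ 0 = L * (s + t) / 2" "X $ 2 = L * (s - t) / 2"
proof -
  have "X $ 1 + X $ (-1) = s * t" "X $ 0 + X $ 2 = L * s"
    "X $ 0 - X $ 2 = L * t" "X $ 1 - X $ (-1) = L\<^sup>2"
    using assms unfolding matrix22_def cplus_def cminus_def vec_eq_iff forall_2 vector_2 by auto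
  then show "X $ 1 = (s * t + L\<^sup>2) / 2" "X $ (-1) = (s * t - L\<^sup>2) / 2"
    "X $ 0 = L * (s + t) / 2" "X $ 2 = L * (s - t) / 2"
    by (simp_all add: algebra_simps)
qed

text \<open>For null vectors X.Y is -1/2 times the square of X - Y. That square is the determinant
  of the matrix difference, whose lower right entry is 0.\<close>

lemma form22_null_vectors:
  assumes "matrix22 X = vector [vector [s * t, L * s], vector [L * t, L\<^sup>2]]"
    and "matrix22 Y = vector [vector [s' * t', L * s'], vector [L * t', L\<^sup>2]]"
  shows "X \<odot> Y = L\<^sup>2 / 2 * ((s - s') * (t - t'))"
  unfolding form22_def null_vector_coords[OF assms(1)] null_vector_coords[OF assms(2)]
  by (simp add: field_simps power2_eq_square)

text \<open>Each r_mn is |a_m - a_n| / (2 sqrt (q_m q_n)); in the quotient the roots of q_i and q_j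
  cancel and that of q_k occurs twice. If a difference in the denominator is 0, both sides are 0
  because x / 0 = 0.\<close>

lemma Lam_rational:
  assumes "\<And>j k. j \<in> I \<Longrightarrow> k \<in> I \<Longrightarrow> (b j - b k) * (q j * q k) = a j - a k"
    and "\<And>j. j \<in> I \<Longrightarrow> q j > 0"
    and "i \<in> I" "j \<in> I" "k \<in> I"
  shows "Lam a b i j k = 2 * \<bar>a i - a j\<bar> * q k / (\<bar>a i - a k\<bar> * \<bar>a j - a k\<bar>)"
proof -
  have r: "rdist a b m n = \<bar>a m - a n\<bar> / (2 * (sqrt (q m) * sqrt (q n)))" if "m \<in> I" "n \<in> I" for m n
  proof -
    have "q m > 0" "q n > 0" using assms(2) that by auto
    then have "b m - b n = (a m - a n) / (q m * q n)"
      using assms(1)[OF that] by (simp add: field_simps)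
    then have "(a m - a n) * (b m - b n) = (a m - a n)\<^sup>2 / (q m * q n)"
      by (simp add: power2_eq_square)
    then show ?thesis
      unfolding rdist_def by (simp add: real_sqrt_divide real_sqrt_mult)
  qed
  have "q i > 0" "q j > 0" "q k > 0" using assms by auto
  moreover have "sqrt (q k) * sqrt (q k) = q k" using \<open>q k > 0\<close> by simp
  ultimately show ?thesis
    unfolding Lam_def r[OF \<open>i \<in> I\<close> \<open>j \<in> I\<close>] r[OF \<open>i \<in> I\<close> \<open>k \<in> I\<close>] r[OF \<open>j \<in> I\<close> \<open>k \<in> I\<close>]
    by (simp add: field_simps)
qed

text \<open>The vanishing third divided difference, multiplied by \<open>(x\<^sub>3 - x\<^sub>1) (x\<^sub>2 - x\<^sub>4)\<close>.\<close>

lemma quadratic_divided_difference: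
  fixes x1 x2 x3 x4 A B C :: real
  assumes "x1 < x3" "x3 < x4" "x4 < x2"
  defines "f \<equiv> \<lambda>x. A + B * x + C * x\<^sup>2"
  shows "- ((x2 - x4) / ((x2 - x1) * (x4 - x1)) * f x1) + (x3 - x1) / ((x2 - x1) * (x2 - x3)) * f x2
       = - ((x2 - x4) / ((x2 - x3) * (x4 - x3)) * f x3) + (x3 - x1) / ((x4 - x1) * (x4 - x3)) * f x4"
proof -
  have nz: "x2 - x1 \<noteq> 0" "x4 - x1 \<noteq> 0" "x2 - x3 \<noteq> 0" "x4 - x3 \<noteq> 0"
    using assms by auto
  define g where "g = (x2 - x1) * (x4 - x1) * (x2 - x3) * (x4 - x3)"
  have g: "g \<noteq> 0" unfolding g_def using nz by simp
  have d: "(x2 - x4) / ((x2 - x1) * (x4 - x1)) = (x2 - x4) * ((x2 - x3) * (x4 - x3)) / g"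
    "(x3 - x1) / ((x2 - x1) * (x2 - x3)) = (x3 - x1) * ((x4 - x1) * (x4 - x3)) / g"
    "(x2 - x4) / ((x2 - x3) * (x4 - x3)) = (x2 - x4) * ((x2 - x1) * (x4 - x1)) / g"
    "(x3 - x1) / ((x4 - x1) * (x4 - x3)) = (x3 - x1) * ((x2 - x1) * (x2 - x3)) / g"
    using nz unfolding g_def by simp_all
  have "- ((x2 - x4) * ((x2 - x3) * (x4 - x3)) * f x1) + (x3 - x1) * ((x4 - x1) * (x4 - x3)) * f x2
      = - ((x2 - x4) * ((x2 - x1) * (x4 - x1)) * f x3) + (x3 - x1) * ((x2 - x1) * (x2 - x3)) * f x4"
    unfolding f_def by algebra
  then have "(- ((x2 - x4) * ((x2 - x3) * (x4 - x3)) * f x1) + (x3 - x1) * ((x4 - x1) * (x4 - x3)) * f x2) / g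
      = (- ((x2 - x4) * ((x2 - x1) * (x4 - x1)) * f x3) + (x3 - x1) * ((x2 - x1) * (x2 - x3)) * f x4) / g"
    by simp
  then show ?thesis
    unfolding d by (simp add: add_divide_distrib diff_divide_distrib)
qed

text \<open>Here t = L (Nb s - Np L) / (Nm s - N L), a Moebius map of determinant L^2 (Np Nm - Nb N)
  = L^4; this is the usual difference formula with denominators cleared.\<close>

lemma moebius_difference:
  fixes s s' t t' :: real
  assumes "Np * Nm - Nb * N = L\<^sup>2"
    and "Nm * t * s - N * t * L - Nb * s * L + Np * L\<^sup>2 = 0"
    and "Nm * t' * s' - N * t' * L - Nb * s' * L + Np * L\<^sup>2 = 0"
  shows "(t - t') * ((Nm * s - N * L) * (Nm * s' - N * L)) = L ^ 4 * (s - s')"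
  using assms by algebra

text \<open>At a zero of the denominator the relation makes the numerator vanish too, so an
  invertible matrix would annihilate the vector (s, 1).\<close>

lemma moebius_denominator_nonzero:
  fixes s t :: real
  assumes "L \<noteq> 0" "Np * Nm - Nb * N = L\<^sup>2"
    and "Nm * t * s - N * t * L - Nb * s * L + Np * L\<^sup>2 = 0"
  shows "Nm * s - N * L \<noteq> 0"
proof
  assume w: "Nm * s - N * L = 0"
  have "L * (Nb * s - Np * L) = 0"
    using assms(3) w by algebra
  then have z: "Nb * s - Np * L = 0" using \<open>L \<noteq> 0\<close> by simp
  have "s * L\<^sup>2 = 0" using assms(2) w z by algebra
  then have "s = 0" using \<open>L \<noteq> 0\<close> by simp
  then have "N = 0" "Np = 0" using w z \<open>L \<noteq> 0\<close> by simp_all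
  then show False using assms(1,2) by simp
qed

section \<open>Momenta of the four points: conservation and invariants\<close>

theorem mainTheorem5:
  fixes L Np N Nb Nm :: real
    and a b :: "nat \<Rightarrow> real"
    and Z p V :: "nat \<Rightarrow> R22"
  assumes "L > 0"
    and "Np * Nm - Nb * N = L ^ 2"
    and "\<forall>j\<in>{1,2,3,4}. Nm * b j * a j - N * b j * L - Nb * a j * L + Np * L ^ 2 = 0"
    and "a 1 < a 3" "a 3 < a 4" "a 4 < a 2"
    and "b 1 < b 3" "b 3 < b 4" "b 4 < b 2"
    and "\<forall>j\<in>{1,2,3,4}. Z j \<odot> Z j = 0 \<and>
           matrix22 (Z j) = vector [vector [a j * b j, L * a j], vector [L * b j, L ^ 2]]"
    and "p 1 = - Lam a b 2 4 1 *\<^sub>R Z 1"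
    and "p 2 = Lam a b 1 3 2 *\<^sub>R Z 2"
    and "p 3 = - Lam a b 2 4 3 *\<^sub>R Z 3"
    and "p 4 = Lam a b 1 3 4 *\<^sub>R Z 4"
    and "V 1 = L ^ 2 *\<^sub>R ((p 3 + p 4) /\<^sub>R (p 3 \<odot> p 4) - (p 1 + p 4) /\<^sub>R (p 1 \<odot> p 4))"
    and "V 2 = L ^ 2 *\<^sub>R ((p 2 - p 1) /\<^sub>R (p 1 \<odot> p 2) - (p 2 - p 3) /\<^sub>R (p 2 \<odot> p 3))"
    and "V 3 = L ^ 2 *\<^sub>R ((p 2 + p 3) /\<^sub>R (p 2 \<odot> p 3) - (p 1 + p 2) /\<^sub>R (p 1 \<odot> p 2))"
    and "V 4 = L ^ 2 *\<^sub>R ((p 3 - p 4) /\<^sub>R (p 3 \<odot> p 4) - (p 1 - p 4) /\<^sub>R (p 1 \<odot> p 4))"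
  shows "p 1 + p 2 = p 3 + p 4
    \<and> p 1 \<odot> p 2 \<noteq> 0 \<and> p 2 \<odot> p 3 \<noteq> 0 \<and> p 3 \<odot> p 4 \<noteq> 0 \<and> p 1 \<odot> p 4 \<noteq> 0
    \<and> (\<forall>i\<in>{1,2,3,4}. V i \<in> AdS3 L)
    \<and> p 1 = V 2 - V 1 \<and> p 2 = V 3 - V 2 \<and> p 3 = V 3 - V 4 \<and> p 4 = V 4 - V 1
    \<and> (\<forall>(i, j)\<in>{(1,2), (2,3), (3,4), (1,4)}. V i \<odot> V j = - (L ^ 2))
    \<and> L ^ 2 - 1 / 2 * (p 1 \<odot> p 4) \<noteq> 0
    \<and> V 3 = ((L ^ 2 + 1 / 2 * (p 1 \<odot> p 4)) / (L ^ 2 - 1 / 2 * (p 1 \<odot> p 4))) *\<^sub>R V 1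
            + (L ^ 2 / (L ^ 2 - 1 / 2 * (p 1 \<odot> p 4))) *\<^sub>R (p 1 + p 4)
    \<and> (V 2 + V 4) \<odot> (V 2 + V 4) \<noteq> 0
    \<and> V 3 = - V 1 - (4 * L ^ 2) *\<^sub>R ((V 2 + V 4) /\<^sub>R ((V 2 + V 4) \<odot> (V 2 + V 4)))"
proof -
  have L0: "L \<noteq> 0" using \<open>L > 0\<close> by simp
  let ?I = "{1, 2, 3, 4} :: nat set"
  define w where "w j = Nm * a j - N * L" for j
  have rel: "Nm * b j * a j - N * b j * L - Nb * a j * L + Np * L ^ 2 = 0"
    and mat: "matrix22 (Z j) = vector [vector [a j * b j, L * a j], vector [L * b j, L\<^sup>2]]"
    and Znull: "Z j \<odot> Z j = 0" if "j \<in> ?I" for j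
    using assms(3,10) that by blast+
  have bw: "(b j - b k) * (w j * w k) = L ^ 4 * (a j - a k)" if "j \<in> ?I" "k \<in> ?I" for j k
    unfolding w_def by (rule moebius_difference[OF assms(2) rel[OF that(1)] rel[OF that(2)]])
  have wn: "w j \<noteq> 0" if "j \<in> ?I" for j
    unfolding w_def by (rule moebius_denominator_nonzero[OF L0 assms(2) rel[OF that]])
  \<comment> \<open>All \<open>w j\<close> share this sign, because the \<open>a j\<close> and
    \<open>b j\<close> are ordered alike. Using \<open>e * w j\<close> for the absolute value keeps
    \<open>q j\<close> affine in \<open>a j\<close>.\<close>
  define e where "e = sgn (w 1)"
  have e: "e = 1 \<or> e = -1" unfolding e_def using wn[of 1] by (auto simp: sgn_if)
  have ew: "e * w j > 0" if "j \<in> ?I" for j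
  proof (cases "j = 1")
    case True
    then show ?thesis using wn[of 1] by (auto simp: e_def sgn_if)
  next
    case False
    then have lt: "a j - a 1 > 0" "b j - b 1 > 0" using that assms(4-9) by auto
    then have "(b j - b 1) * (w j * w 1) > 0" using bw[of j 1] that L0 by simp
    then have "w j * w 1 > 0" using lt(2) by (simp add: zero_less_mult_iff)
    then show ?thesis by (auto simp: e_def sgn_if zero_less_mult_iff)
  qed
  define q where "q j = e * w j / L\<^sup>2" for j
  have q: "q j > 0" if "j \<in> ?I" for j
    unfolding q_def using ew[OF that] L0 by simp
  have bq: "(b j - b k) * (q j * q k) = a j - a k" if "j \<in> ?I" "k \<in> ?I" for j k
  proof -
    have "(b j - b k) * (q j * q k) = (e * e) * ((b j - b k) * (w j * w k)) / L ^ 4"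
      unfolding q_def by (simp add: field_simps power4_eq_xxxx power2_eq_square)
    then show ?thesis using e L0 bw[OF that] by auto
  qed
  note Lam = Lam_rational[of ?I b q a, OF bq q]
  have L1: "Lam a b 2 4 1 = 2 * ((a 2 - a 4) / ((a 2 - a 1) * (a 4 - a 1))) * q 1"
    and L2: "Lam a b 1 3 2 = 2 * ((a 3 - a 1) / ((a 2 - a 1) * (a 2 - a 3))) * q 2"
    and L3: "Lam a b 2 4 3 = 2 * ((a 2 - a 4) / ((a 2 - a 3) * (a 4 - a 3))) * q 3"
    and L4: "Lam a b 1 3 4 = 2 * ((a 3 - a 1) / ((a 4 - a 1) * (a 4 - a 3))) * q 4"
    using assms(4-6) by (subst Lam; simp)+
  \<comment> \<open>The factor \<open>q j\<close> cancels the Moebius denominator, so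
    \<open>q j * b j\<close> is affine in \<open>a j\<close> as well.\<close>
  have qb: "q j * b j = e * (Nb * a j - Np * L) / L" if "j \<in> ?I" for j
  proof -
    have "w j * b j = L * (Nb * a j - Np * L)"
      using rel[OF that] unfolding w_def by algebra
    then have "q j * b j = e * (L * (Nb * a j - Np * L)) / L\<^sup>2"
      unfolding q_def by (metis mult.assoc times_divide_eq_left)
    then show ?thesis using L0 by (simp add: power2_eq_square)
  qed
  \<comment> \<open>The entries of the matrix of \<open>Z j\<close>, times \<open>q j\<close>, are
    affine functions of \<open>a j\<close> (namely \<open>q j\<close> and \<open>q j * b j\<close>)
    or \<open>a j\<close> times such, up to constants; hence degree at most 2.\<close>
  have quad: "\<exists>A B C. \<forall>j\<in>?I. q j * Z j $ i = A + B * a j + C * (a j)\<^sup>2" for i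
  proof -
    have qj: "q j = e * (Nm * a j - N * L) / L\<^sup>2" for j
      unfolding q_def w_def ..
    have h1: "q j * Z j $ 1 = (a j * (q j * b j) + L\<^sup>2 * q j) / 2"
      and h2: "q j * Z j $ (-1) = (a j * (q j * b j) - L\<^sup>2 * q j) / 2"
      and h3: "q j * Z j $ 0 = L * (a j * q j + q j * b j) / 2"
      and h4: "q j * Z j $ 2 = L * (a j * q j - q j * b j) / 2" if "j \<in> ?I" for j
      unfolding null_vector_coords[OF mat[OF that]] by (simp_all add: algebra_simps)
    have "\<forall>j\<in>?I. q j * Z j $ 1
        = - e * N * L / 2 + (e * Nm / 2 - e * Np / 2) * a j + (e * Nb / L / 2) * (a j)\<^sup>2"
      using L0 by (intro ballI) (simp only: h1 qb, simp add: qj field_simps power2_eq_square)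
    moreover have "\<forall>j\<in>?I. q j * Z j $ (-1)
        = e * N * L / 2 + (- e * Nm / 2 - e * Np / 2) * a j + (e * Nb / L / 2) * (a j)\<^sup>2"
      using L0 by (intro ballI) (simp only: h2 qb, simp add: qj field_simps power2_eq_square)
    moreover have "\<forall>j\<in>?I. q j * Z j $ 0
        = - e * Np * L / 2 + (e * Nb / 2 - e * N / 2) * a j + (e * Nm / L / 2) * (a j)\<^sup>2"
      using L0 by (intro ballI) (simp only: h3 qb, simp add: qj field_simps power2_eq_square)
    moreover have "\<forall>j\<in>?I. q j * Z j $ 2
        = e * Np * L / 2 + (- e * Nb / 2 - e * N / 2) * a j + (e * Nm / L / 2) * (a j)\<^sup>2"
      using L0 by (intro ballI) (simp only: h4 qb, simp add: qj field_simps power2_eq_square)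
    moreover have "i = 1 \<or> i = 2 \<or> i = -1 \<or> i = 0"
    proof -
      have "(4::4) = 0" "(3::4) = -1" by simp_all
      then show ?thesis using exhaust_4[of i] by metis
    qed
    ultimately show ?thesis by metis
  qed
  have cons: "p 1 + p 2 = p 3 + p 4"
    unfolding vec_eq_iff
  proof
    fix i
    obtain A B C where ABC: "\<And>j. j \<in> ?I \<Longrightarrow> q j * Z j $ i = A + B * a j + C * (a j)\<^sup>2"
      using quad[of i] by blast
    \<comment> \<open>This supplies the factor 2 common to \<open>L1\<close>, ...,
      \<open>L4\<close>.\<close>
    have lin: "- c1 * g1 + c2 * g2 = - c3 * g3 + c4 * g4"
      if "- (c1 * (r1 * z1)) + c2 * (r2 * z2) = - (c3 * (r3 * z3)) + c4 * (r4 * z4)"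
        and "g1 = 2 * r1 * z1" "g2 = 2 * r2 * z2" "g3 = 2 * r3 * z3" "g4 = 2 * r4 * z4"
      for c1 c2 c3 c4 r1 r2 r3 r4 z1 z2 z3 z4 g1 g2 g3 g4 :: real
      using that by algebra
    have "- ((a 2 - a 4) / ((a 2 - a 1) * (a 4 - a 1)) * (q 1 * Z 1 $ i))
        + (a 3 - a 1) / ((a 2 - a 1) * (a 2 - a 3)) * (q 2 * Z 2 $ i)
      = - ((a 2 - a 4) / ((a 2 - a 3) * (a 4 - a 3)) * (q 3 * Z 3 $ i))
        + (a 3 - a 1) / ((a 4 - a 1) * (a 4 - a 3)) * (q 4 * Z 4 $ i)"
      using quadratic_divided_difference[OF assms(4-6), of A B C] ABC by simp
    from lin[OF this refl refl refl refl]
    show "(p 1 + p 2) $ i = (p 3 + p 4) $ i"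
      unfolding assms(11-14) L1 L2 L3 L4 vector_add_component vector_scaleR_component real_scaleR_def
      by (simp only: mult_minus_left mult.assoc mult.left_commute[of _ 2])
  qed
  have ZZ: "q j * q k * (Z j \<odot> Z k) = L\<^sup>2 / 2 * (a j - a k)\<^sup>2" if "j \<in> ?I" "k \<in> ?I" for j k
  proof -
    have "q j * q k * (Z j \<odot> Z k) = L\<^sup>2 / 2 * ((a j - a k) * ((b j - b k) * (q j * q k)))"
      unfolding form22_null_vectors[OF mat[OF that(1)] mat[OF that(2)]] by simp
    then show ?thesis unfolding bq[OF that] by (simp add: power2_eq_square)
  qed
  \<comment> \<open>The invariants will be u = -2 L^2 d / m and v = -2 L^2 d / n, and Ptolemy's
    relation for the four ordered points reads m = d + n.\<close>
  define d where "d = (a 3 - a 1) * (a 2 - a 4)"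
  define m where "m = (a 2 - a 3) * (a 4 - a 1)"
  define n where "n = (a 2 - a 1) * (a 4 - a 3)"
  have pos: "d > 0" "m > 0" "n > 0"
    unfolding d_def m_def n_def using assms(4-6) by auto
  have ptolemy: "m = d + n"
    unfolding d_def m_def n_def by (simp add: algebra_simps)
  have diffs: "a 2 - a 1 \<noteq> 0" "a 2 - a 3 \<noteq> 0" "a 4 - a 1 \<noteq> 0" "a 4 - a 3 \<noteq> 0"
    using assms(4-6) by auto
  have prod: "(- (2 * c * x) *\<^sub>R X) \<odot> ((2 * c' * y) *\<^sub>R Y) = - 4 * c * c' * (x * y * (X \<odot> Y))"
    for c c' x y and X Y :: R22
    unfolding form22_bilinear by simp
  \<comment> \<open>The difference s shared by both coefficients cancels the square from
    \<open>ZZ\<close>. The two versions serve \<open>u\<close> and \<open>v\<close>, where s stands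
    first or second in the first denominator.\<close>
  have cancel: "- 4 * (x / (s * t)) * (y / (s * r)) * (L\<^sup>2 / 2 * (s * s)) = - 2 * L\<^sup>2 * (y * x) / (r * t)"
    "- 4 * (x / (t * s)) * (y / (s * r)) * (L\<^sup>2 / 2 * (s * s)) = - 2 * L\<^sup>2 * (y * x) / (t * r)"
    if "s \<noteq> 0" for x y r s t :: real
    using that by (simp_all add: ac_simps)
  have u: "p 1 \<odot> p 2 = - 2 * L\<^sup>2 * d / m"
  proof -
    have "p 1 \<odot> p 2 = - 4 * ((a 2 - a 4) / ((a 2 - a 1) * (a 4 - a 1)))
        * ((a 3 - a 1) / ((a 2 - a 1) * (a 2 - a 3))) * (q 1 * q 2 * (Z 1 \<odot> Z 2))"
      unfolding assms(11,12) L1 L2 by (rule prod)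
    also have "q 1 * q 2 * (Z 1 \<odot> Z 2) = L\<^sup>2 / 2 * ((a 2 - a 1) * (a 2 - a 1))"
      using ZZ[of 1 2] by (simp add: power2_eq_square algebra_simps)
    finally show ?thesis
      unfolding d_def m_def by (simp only: cancel(1)[OF diffs(1)])
  qed
  have v: "p 1 \<odot> p 4 = - 2 * L\<^sup>2 * d / n"
  proof -
    have "p 1 \<odot> p 4 = - 4 * ((a 2 - a 4) / ((a 2 - a 1) * (a 4 - a 1)))
        * ((a 3 - a 1) / ((a 4 - a 1) * (a 4 - a 3))) * (q 1 * q 4 * (Z 1 \<odot> Z 4))"
      unfolding assms(11,14) L1 L4 by (rule prod)
    also have "q 1 * q 4 * (Z 1 \<odot> Z 4) = L\<^sup>2 / 2 * ((a 4 - a 1) * (a 4 - a 1))"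
      using ZZ[of 1 4] by (simp add: power2_eq_square algebra_simps)
    finally show ?thesis
      unfolding d_def n_def by (simp only: cancel(2)[OF diffs(3)])
  qed
  have u0: "p 1 \<odot> p 2 \<noteq> 0" and v0: "p 1 \<odot> p 4 < 0"
    unfolding u v using pos L0 by simp_all
  have uv: "(p 1 \<odot> p 2) * (p 1 \<odot> p 4) = 2 * L ^ 2 * (p 1 \<odot> p 2 - p 1 \<odot> p 4)"
  proof -
    \<comment> \<open>Now u = c / m and v = c / n. As m - n = d, their product is c / d = -2 L^2
      times v - u.\<close>
    define c where "c = - 2 * L\<^sup>2 * d"
    have "c / n - c / m = c * d / (n * m)"
      using pos ptolemy diff_frac_eq[of n m c c] by (simp add: algebra_simps)
    then have "c / m * (c / n) = c * (c / n - c / m) / d"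
      using pos by simp
    also have "c * z / d = 2 * L\<^sup>2 * - z" for z
      unfolding c_def using pos by simp
    finally show ?thesis
      unfolding u v c_def minus_diff_eq .
  qed
  have null: "p 1 \<odot> p 1 = 0" "p 2 \<odot> p 2 = 0" "p 3 \<odot> p 3 = 0" "p 4 \<odot> p 4 = 0"
    unfolding assms(11-14) form22_bilinear by (simp_all add: Znull)
  note sheet = scattering_world_sheet[OF \<open>L > 0\<close> null cons u0 v0 uv assms(15-18)]
  have "\<forall>i\<in>{1,2,3,4}. V i \<in> AdS3 L"
    using sheet(2) by simp
  moreover have "\<forall>(i, j)\<in>{(1,2), (2,3), (3,4), (1,4)}. V i \<odot> V j = - (L ^ 2)"
    using sheet(4) by simp
  ultimately show ?thesis
    using cons sheet(1,3,5-8) by (elim conjE) (intro conjI; assumption)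
qed

end
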